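(* The category $\mathsf{SKB}$ of skew braces does not satisfy condition (NH) (normality of Higgins commutators of normal subobjects): there exist a skew brace $(A,+,\circ)$ and an ideal $I$ of $A$ such that the Higgins commutator $[I,I]^H$ is not an ideal of $A$.
   Context: A skew brace is a triple $(A,+,\circ)$ where $(A,+)$ and $(A,\circ)$ are groups sharing the same identity element and satisfying $a\circ(b+c)=a\circ b-a+a\circ c$ for all $a,b,c\in A$. Write $a^{-\circ}$ for the inverse of $a$ in $(A,\circ)$ and $\lambda_a(x):=-a+a\circ x$. An ideal (equivalently, a normal subobject in $\mathsf{SKB}$) of $A$ is a subset $X\subseteq A$ that is a normal subgroup of $(A,+)$, a normal subgroup of $(A,\circ)$, and satisfies $\lambda_a(X)\subseteq X$ for all $a\in A$. The join $I\vee J$ of two ideals is the ideal of $A$ generated by $I\cup J$; it is itself a skew brace. Given two ideals $I,J$ of $A$, the Higgins commutator $[I,J]^H$ is the ideal of the skew brace $I\vee J$ generated by the elements (i) $-i-j+i+j$ for $i\in I$, $j\in J$; (ii) $-i^{-\circ}-j^{-\circ}+(i+j)^{-\circ}$ for $i\in I$, $j\in J$; (iii) $-(i_1\circ i_2)-(j_1\circ j_2)+(i_1+j_1)\circ(i_2+j_2)$ for $i_1,i_2\in I$, $j_1,j_2\in J$. Condition (NH) for $\mathsf{SKB}$ says: for every skew brace $A$ and all ideals $I,J$ of $A$, the Higgins commutator $[I,J]^H$ is an ideal of $A$. *)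

theory Defs
  imports "HOL-Algebra.Coset" "HOL-Algebra.Ring"
begin

(* The record type of HOL-Algebra rings carries the signature of a skew brace: \<oplus>, \<zero>, \<ominus> denote
   the (not necessarily abelian) additive group, and \<otimes>, \<one>, inv denote the circle group. *)

locale skew_brace =
  fixes A (structure)
  assumes add_group: "group (add_monoid A)"
    and circ_group: "group A"
    and same_identity: "\<one> = \<zero>"
    and skew_distrib: "\<lbrakk>a \<in> carrier A; b \<in> carrier A; c \<in> carrier A\<rbrakk>
      \<Longrightarrow> a \<otimes> (b \<oplus> c) = a \<otimes> b \<ominus> a \<oplus> a \<otimes> c"

definition lambda_map :: "('a, 'm) ring_scheme \<Rightarrow> 'a \<Rightarrow> 'a \<Rightarrow> 'a"
  where "lambda_map A a x = \<ominus>\<^bsub>A\<^esub> a \<oplus>\<^bsub>A\<^esub> a \<otimes>\<^bsub>A\<^esub> x"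

definition skb_ideal :: "'a set \<Rightarrow> ('a, 'm) ring_scheme \<Rightarrow> bool"
  where "skb_ideal X A \<longleftrightarrow>
    X \<lhd> add_monoid A \<and> X \<lhd> A \<and> (\<forall>a \<in> carrier A. lambda_map A a ` X \<subseteq> X)"

definition skb_genideal :: "('a, 'm) ring_scheme \<Rightarrow> 'a set \<Rightarrow> 'a set"
  where "skb_genideal A S = \<Inter> {X. skb_ideal X A \<and> S \<subseteq> X}"

definition ideal_join :: "('a, 'm) ring_scheme \<Rightarrow> 'a set \<Rightarrow> 'a set \<Rightarrow> 'a set"
  where "ideal_join A I J = skb_genideal A (I \<union> J)"

definition higgins_generators :: "('a, 'm) ring_scheme \<Rightarrow> 'a set \<Rightarrow> 'a set \<Rightarrow> 'a set"
  where "higgins_generators A I J =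
    {\<ominus>\<^bsub>A\<^esub> i \<ominus>\<^bsub>A\<^esub> j \<oplus>\<^bsub>A\<^esub> i \<oplus>\<^bsub>A\<^esub> j | i j. i \<in> I \<and> j \<in> J} \<union>
    {\<ominus>\<^bsub>A\<^esub> (inv\<^bsub>A\<^esub> i) \<ominus>\<^bsub>A\<^esub> (inv\<^bsub>A\<^esub> j) \<oplus>\<^bsub>A\<^esub> inv\<^bsub>A\<^esub> (i \<oplus>\<^bsub>A\<^esub> j) | i j. i \<in> I \<and> j \<in> J} \<union>
    {\<ominus>\<^bsub>A\<^esub> (i1 \<otimes>\<^bsub>A\<^esub> i2) \<ominus>\<^bsub>A\<^esub> (j1 \<otimes>\<^bsub>A\<^esub> j2) \<oplus>\<^bsub>A\<^esub> (i1 \<oplus>\<^bsub>A\<^esub> j1) \<otimes>\<^bsub>A\<^esub> (i2 \<oplus>\<^bsub>A\<^esub> j2) | i1 i2 j1 j2.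
      i1 \<in> I \<and> i2 \<in> I \<and> j1 \<in> J \<and> j2 \<in> J}"

(* The ideal is generated inside the sub-skew-brace I \<or> J, not inside A. *)
definition higgins_commutator :: "('a, 'm) ring_scheme \<Rightarrow> 'a set \<Rightarrow> 'a set \<Rightarrow> 'a set"
  where "higgins_commutator A I J =
    skb_genideal (A\<lparr>carrier := ideal_join A I J\<rparr>) (higgins_generators A I J)"

(* HOL cannot quantify over types inside a formula, so condition (NH) is relative to the type in which
   the carriers live. Failure for one type refutes (NH) for the class of all skew braces. *)
definition condition_NH :: "'a itself \<Rightarrow> bool"
  where "condition_NH (_ :: 'a itself) \<longleftrightarrow>
    (\<forall>(A :: 'a ring) I J. skew_brace A \<longrightarrow> skb_ideal I A \<longrightarrow> skb_ideal J A
      \<longrightarrow> skb_ideal (higgins_commutator A I J) A)"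

end

(* The commutator [I,I]^H is the least ideal of I whose quotient is a trivial brace with abelian
   addition. It is invariant under all lambda_a, but conjugation by a in the circle group is not an
   automorphism of (I,+), so it need not preserve [I,I]^H. Take A = Z/4 x Z/4 additively, with
   lambda_{(x,y)}(u,v) = ((-1)^x u, (-1)^{x div 2} v). For the ideal I of the pairs with even second
   coordinate, [I,I]^H = {(0,0), (2,0)}, but conjugating (2,0) by (0,1) in the circle group
   gives (2,2). *)
theory Submission
  imports Defs
begin

(* The pair (x,y) in Z/4 x Z/4 is encoded as the natural number 4 x + y < 16. *)

definition signed4 :: "bool \<Rightarrow> nat \<Rightarrow> nat"
  where "signed4 b v = (if b then 3 * v else v) mod 4"

definition add4 :: "nat \<Rightarrow> nat \<Rightarrow> nat"
  where "add4 m n = 4 * ((m div 4 + n div 4) mod 4) + (m mod 4 + n mod 4) mod 4"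

definition neg4 :: "nat \<Rightarrow> nat"
  where "neg4 m = 4 * signed4 True (m div 4) + signed4 True (m mod 4)"

text \<open>For the element (x,y), \<open>m div 4\<close> is x and \<open>m div 8\<close> is x div
  2, so the low and the high bit of x choose the signs on the first and the second
  coordinate.\<close>

definition lam4 :: "nat \<Rightarrow> nat \<Rightarrow> nat"
  where "lam4 m n = 4 * signed4 (odd (m div 4)) (n div 4) + signed4 (odd (m div 8)) (n mod 4)"

definition circ4 :: "nat \<Rightarrow> nat \<Rightarrow> nat"
  where "circ4 m n = add4 m (lam4 m n)"

text \<open>The circle inverse is the preimage of -m under \<open>lam4 m\<close>; this map is an
  involution, hence its own inverse.\<close>

definition cinv4 :: "nat \<Rightarrow> nat"
  where "cinv4 m = lam4 m (neg4 m)"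

lemmas ops4_defs = circ4_def cinv4_def add4_def neg4_def lam4_def signed4_def

lemma all_less_16: "(\<forall>n<16. P n) \<longleftrightarrow> P (0::nat) \<and> P 1 \<and> P 2 \<and> P 3 \<and> P 4 \<and> P 5 \<and> P 6 \<and> P 7
    \<and> P 8 \<and> P 9 \<and> P 10 \<and> P 11 \<and> P 12 \<and> P 13 \<and> P 14 \<and> P 15"
  by (simp add: numeral_eq_Suc All_less_Suc conj_ac)

lemma signed4_less: "signed4 b v < 4"
  by (simp add: signed4_def)

lemma signed4_signed4: "signed4 a (signed4 b v) = signed4 (a \<noteq> b) v"
proof -
  \<comment> \<open>Negation is multiplication by 3, so negating twice multiplies by 9.\<close>
  have "9 * v mod 4 = v mod 4" by presburger
  then show ?thesis by (auto simp: signed4_def mod_simps)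
qed

lemma signed4_add: "signed4 b ((u + v) mod 4) = (signed4 b u + signed4 b v) mod 4"
  by (simp add: signed4_def mod_simps distrib_left)

lemma div_mod_4_pair: "p < 4 \<Longrightarrow> q < 4 \<Longrightarrow> (4 * p + q) div 4 = p \<and> (4 * p + q) mod 4 = (q::nat)"
  by simp

lemma add4_div_mod:
  "add4 m n div 4 = (m div 4 + n div 4) mod 4" "add4 m n mod 4 = (m mod 4 + n mod 4) mod 4"
  using div_mod_4_pair[of "(m div 4 + n div 4) mod 4" "(m mod 4 + n mod 4) mod 4"]
  by (simp_all add: add4_def)

lemma lam4_div_mod:
  "lam4 m n div 4 = signed4 (odd (m div 4)) (n div 4)"
  "lam4 m n mod 4 = signed4 (odd (m div 8)) (n mod 4)"
  using div_mod_4_pair[OF signed4_less signed4_less] by (simp_all add: lam4_def)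

lemma add4_less: "add4 m n < 16"
proof -
  have "(m div 4 + n div 4) mod 4 < 4" "(m mod 4 + n mod 4) mod 4 < 4" by simp_all
  then show ?thesis unfolding add4_def by linarith
qed

lemma lam4_less: "lam4 m n < 16"
  using signed4_less[of "odd (m div 4)" "n div 4"] signed4_less[of "odd (m div 8)" "n mod 4"]
  unfolding lam4_def by linarith

lemma neg4_less: "neg4 m < 16"
  using signed4_less[of True "m div 4"] signed4_less[of True "m mod 4"]
  unfolding neg4_def by linarith

lemma add4_assoc: "add4 (add4 m n) k = add4 m (add4 n k)"
  unfolding add4_def[of "add4 m n"] add4_def[of m "add4 n k"] add4_div_mod
  by (simp only: mod_simps add.assoc)

lemma add4_commute: "add4 m n = add4 n m"
  by (simp add: add4_def add.commute)

lemma lam4_add4: "lam4 m (add4 n k) = add4 (lam4 m n) (lam4 m k)"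
  by (simp only: lam4_def[of m "add4 n k"] add4_def[of "lam4 m n"] add4_div_mod lam4_div_mod
      signed4_add)

text \<open>The circle operation acts on first coordinates by x + (-1)^x u, which adds the two bits
  of x without carry: a Klein four-group on Z/4. These bits are exactly what \<open>lam4\<close>
  reads, so this finite check makes \<open>lam4\<close> multiplicative for
  \<open>circ4\<close>.\<close>

lemma odd_div_circ4:
  assumes "m < 16" "n < 16"
  shows "odd (circ4 m n div 4) \<longleftrightarrow> odd (m div 4) \<noteq> odd (n div 4)"
    and "odd (circ4 m n div 8) \<longleftrightarrow> odd (m div 8) \<noteq> odd (n div 8)"
proof -
  have "\<forall>m<16. \<forall>n<16. (odd (circ4 m n div 4) \<longleftrightarrow> odd (m div 4) \<noteq> odd (n div 4)) \<and>
      (odd (circ4 m n div 8) \<longleftrightarrow> odd (m div 8) \<noteq> odd (n div 8))"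
    unfolding all_less_16 by (simp add: ops4_defs)
  from this[rule_format, OF assms] show "odd (circ4 m n div 4) \<longleftrightarrow> odd (m div 4) \<noteq> odd (n div 4)"
    and "odd (circ4 m n div 8) \<longleftrightarrow> odd (m div 8) \<noteq> odd (n div 8)"
    by (simp_all only:)
qed

lemma lam4_circ4:
  assumes "m < 16" "n < 16"
  shows "lam4 (circ4 m n) k = lam4 m (lam4 n k)"
  by (simp only: lam4_def[of "circ4 m n"] lam4_def[of m "lam4 n k"] lam4_div_mod
      odd_div_circ4[OF assms] signed4_signed4)

text \<open>Both sides expand to m + \<lambda>_m(n) + \<lambda>_m(\<lambda>_n(k)), by additivity and
  multiplicativity of \<lambda>.\<close>

lemma circ4_assoc:
  assumes "m < 16" "n < 16"
  shows "circ4 (circ4 m n) k = circ4 m (circ4 n k)"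
  by (simp only: circ4_def[of "circ4 m n"] lam4_circ4[OF assms])
    (simp only: circ4_def lam4_add4 add4_assoc)

lemma ops4_unit_inverse:
  assumes "m < 16"
  shows "add4 0 m = m" "add4 (neg4 m) m = 0" "circ4 0 m = m" "circ4 (cinv4 m) m = 0"
    "circ4 m 0 = m"
proof -
  have "\<forall>m<16. add4 0 m = m \<and> add4 (neg4 m) m = 0 \<and> circ4 0 m = m \<and> circ4 (cinv4 m) m = 0
      \<and> circ4 m 0 = m"
    unfolding all_less_16 by (simp add: ops4_defs)
  from this[rule_format, OF assms] show "add4 0 m = m" "add4 (neg4 m) m = 0" "circ4 0 m = m" "circ4 (cinv4 m) m = 0"
    "circ4 m 0 = m"
    by (simp_all only:)
qed

section \<open>Skew braces on closed subsets\<close>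

text \<open>The carrier is a parameter because the commutator is generated inside the smaller brace
  on I, with the same operations.\<close>

definition brace4 :: "nat set \<Rightarrow> nat ring"
  where "brace4 S = \<lparr>carrier = S, mult = circ4, one = 0, zero = 0, add = add4\<rparr>"

text \<open>Closure under \<open>circ4\<close> and \<open>cinv4\<close> follows, as both are
  composed of the listed operations.\<close>

definition closed4 :: "nat set \<Rightarrow> bool"
  where "closed4 S \<longleftrightarrow> S \<subseteq> {..<16} \<and> 0 \<in> S \<and>
    (\<forall>m\<in>S. neg4 m \<in> S \<and> (\<forall>n\<in>S. add4 m n \<in> S \<and> lam4 m n \<in> S))"

lemma brace4_simps [simp]:
  "carrier (brace4 S) = S" "x \<otimes>\<^bsub>brace4 S\<^esub> y = circ4 x y" "x \<oplus>\<^bsub>brace4 S\<^esub> y = add4 x y"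
  "\<one>\<^bsub>brace4 S\<^esub> = 0" "\<zero>\<^bsub>brace4 S\<^esub> = 0" "brace4 S\<lparr>carrier := T\<rparr> = brace4 T"
  by (simp_all add: brace4_def)

lemma closed4D:
  assumes "closed4 S" "m \<in> S"
  shows "m < 16" "neg4 m \<in> S" "cinv4 m \<in> S"
    "n \<in> S \<Longrightarrow> add4 m n \<in> S" "n \<in> S \<Longrightarrow> lam4 m n \<in> S" "n \<in> S \<Longrightarrow> circ4 m n \<in> S"
  using assms by (auto simp: closed4_def circ4_def cinv4_def)

lemma closed4_0: "closed4 S \<Longrightarrow> 0 \<in> S"
  by (simp add: closed4_def)

lemma group_add_brace4:
  assumes "closed4 S"
  shows "group (add_monoid (brace4 S))"
proof (rule groupI)
  fix m assume "m \<in> carrier (add_monoid (brace4 S))"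
  then show "\<exists>n\<in>carrier (add_monoid (brace4 S)). n \<otimes>\<^bsub>add_monoid (brace4 S)\<^esub> m = \<one>\<^bsub>add_monoid (brace4 S)\<^esub>"
    by (auto simp: closed4D[OF assms] ops4_unit_inverse intro!: bexI[of _ "neg4 m"])
qed (auto simp: closed4D[OF assms] closed4_0[OF assms] add4_assoc ops4_unit_inverse)

lemma group_brace4:
  assumes "closed4 S"
  shows "group (brace4 S)"
proof (rule groupI)
  fix m assume "m \<in> carrier (brace4 S)"
  then show "\<exists>n\<in>carrier (brace4 S). n \<otimes>\<^bsub>brace4 S\<^esub> m = \<one>\<^bsub>brace4 S\<^esub>"
    by (auto simp: closed4D[OF assms] ops4_unit_inverse intro!: bexI[of _ "cinv4 m"])
qed (auto simp: closed4D[OF assms] closed4_0[OF assms] circ4_assoc ops4_unit_inverse)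

lemma a_inv_brace4:
  assumes "closed4 S" "m \<in> S"
  shows "\<ominus>\<^bsub>brace4 S\<^esub> m = neg4 m"
  unfolding a_inv_def
  by (rule group.inv_equality[OF group_add_brace4[OF assms(1)]])
    (use assms in \<open>auto simp: closed4D[OF assms] ops4_unit_inverse\<close>)

lemma m_inv_brace4:
  assumes "closed4 S" "m \<in> S"
  shows "inv\<^bsub>brace4 S\<^esub> m = cinv4 m"
  by (rule group.inv_equality[OF group_brace4[OF assms(1)]])
    (use assms in \<open>auto simp: closed4D[OF assms] ops4_unit_inverse\<close>)

lemma add4_cancel: "m < 16 \<Longrightarrow> n < 16 \<Longrightarrow> add4 (neg4 m) (add4 m n) = n"
  by (simp add: add4_assoc[symmetric] ops4_unit_inverse)

text \<open>Since a \<circ> c = a + \<lambda>_a(c), the term -a + a \<circ> c collapses to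
  \<lambda>_a(c), and the law becomes additivity of \<lambda>_a.\<close>

lemma skew_brace_brace4:
  assumes S: "closed4 S"
  shows "skew_brace (brace4 S)"
proof (rule skew_brace.intro)
  fix a b c
  assume "a \<in> carrier (brace4 S)" "b \<in> carrier (brace4 S)" "c \<in> carrier (brace4 S)"
  then have abc: "a \<in> S" "b \<in> S" "c \<in> S" by simp_all
  have "add4 (add4 (circ4 a b) (neg4 a)) (circ4 a c)
      = add4 (circ4 a b) (add4 (neg4 a) (add4 a (lam4 a c)))"
    by (simp add: add4_assoc circ4_def)
  also have "\<dots> = add4 (circ4 a b) (lam4 a c)"
    using closed4D(1)[OF S abc(1)] by (simp add: add4_cancel lam4_less)
  also have "\<dots> = circ4 a (add4 b c)"
    by (simp add: circ4_def lam4_add4 add4_assoc)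
  finally show "a \<otimes>\<^bsub>brace4 S\<^esub> (b \<oplus>\<^bsub>brace4 S\<^esub> c)
      = a \<otimes>\<^bsub>brace4 S\<^esub> b \<ominus>\<^bsub>brace4 S\<^esub> a \<oplus>\<^bsub>brace4 S\<^esub> a \<otimes>\<^bsub>brace4 S\<^esub> c"
    by (simp add: a_minus_def a_inv_brace4[OF S abc(1)])
qed (use group_add_brace4[OF S] group_brace4[OF S] in simp_all)

lemma lambda_map_brace4:
  assumes "closed4 S" "a \<in> S"
  shows "lambda_map (brace4 S) a x = lam4 a x"
  using closed4D(1)[OF assms]
  by (simp add: lambda_map_def a_inv_brace4[OF assms] circ4_def add4_cancel lam4_less)

text \<open>Addition is commutative, so additive normality is automatic; only \<lambda>-invariance
  and circle conjugation have to be checked.\<close>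

lemma skb_ideal_brace4I:
  assumes S: "closed4 S" and T: "closed4 T" "T \<subseteq> S"
    and lam: "\<And>m n. m \<in> S \<Longrightarrow> n \<in> T \<Longrightarrow> lam4 m n \<in> T"
    and conj: "\<And>m n. m \<in> S \<Longrightarrow> n \<in> T \<Longrightarrow> circ4 (circ4 m n) (cinv4 m) \<in> T"
  shows "skb_ideal T (brace4 S)"
proof -
  interpret add: group "add_monoid (brace4 S)" by (rule group_add_brace4[OF S])
  interpret circ: group "brace4 S" by (rule group_brace4[OF S])
  have add_inv: "inv\<^bsub>add_monoid (brace4 S)\<^esub> m = neg4 m" if "m \<in> S" for m
    using a_inv_brace4[OF S that] by (simp add: a_inv_def)
  note add_inv = add_inv[simplified]
  have inT: "m \<in> S" if "m \<in> T" for m using that T(2) by blast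
  have "subgroup T (add_monoid (brace4 S))"
    by (rule add.subgroupI)
      (use T(2) closed4_0[OF T(1)] in \<open>auto simp: add_inv inT closed4D[OF T(1)]\<close>)
  moreover have "add4 (add4 m n) (neg4 m) \<in> T" if "m \<in> S" "n \<in> T" for m n
  proof -
    have "add4 (add4 m n) (neg4 m) = n"
      using closed4D(1)[OF S that(1)] closed4D(1)[OF T(1) that(2)]
      by (metis add4_cancel add4_commute)
    with that show ?thesis by simp
  qed
  ultimately have "T \<lhd> add_monoid (brace4 S)"
    unfolding add.normal_inv_iff by (auto simp: add_inv)
  moreover have "subgroup T (brace4 S)"
    by (rule circ.subgroupI)
      (use T(2) closed4_0[OF T(1)] in \<open>auto simp: m_inv_brace4[OF S] inT closed4D[OF T(1)]\<close>)
  then have "T \<lhd> brace4 S"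
    by (auto simp: circ.normal_inv_iff m_inv_brace4[OF S] conj)
  ultimately show ?thesis
    by (auto simp: skb_ideal_def lambda_map_brace4[OF S] lam)
qed

section \<open>The ideal I and its quotient by {0, 8}\<close>

definition evens16 :: "nat set"
  where "evens16 = {0, 2, 4, 6, 8, 10, 12, 14}"

lemma closed4_full: "closed4 {..<16}"
  by (auto simp: closed4_def neg4_less add4_less lam4_less)

lemma closed4_evens16: "closed4 evens16"
  unfolding closed4_def evens16_def ball_simps by (simp add: ops4_defs)

lemma closed4_0_8: "closed4 {0, 8}"
  by (simp add: closed4_def ops4_defs)

lemma skb_ideal_evens16: "skb_ideal evens16 (brace4 {..<16})"
proof -
  have "\<forall>m<16. \<forall>n\<in>evens16. lam4 m n \<in> evens16 \<and> circ4 (circ4 m n) (cinv4 m) \<in> evens16"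
    unfolding all_less_16 evens16_def ball_simps by (simp add: ops4_defs)
  then show ?thesis
    using closed4D(1)[OF closed4_evens16]
    by (auto intro!: skb_ideal_brace4I[OF closed4_full closed4_evens16] simp del: insert_iff)
qed

text \<open>In the circle group (2,0) commutes with (x,y) exactly when 2y = 0 in Z/4. This holds
  throughout I, where y is even, but not in the whole brace.\<close>

lemma skb_ideal_0_8: "skb_ideal {0, 8} (brace4 evens16)"
proof -
  have "\<forall>m\<in>evens16. \<forall>n\<in>{0, 8}. lam4 m n \<in> {0, 8} \<and> circ4 (circ4 m n) (cinv4 m) \<in> {0, 8}"
    unfolding evens16_def ball_simps by (simp add: ops4_defs)
  note closed_under = this[THEN bspec, THEN bspec]
  show ?thesis
  proof (rule skb_ideal_brace4I[OF closed4_evens16 closed4_0_8])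
    show "{0, 8} \<subseteq> evens16" by (simp add: evens16_def)
  qed (simp_all only: closed_under)
qed

lemma skb_genideal_self: "skb_ideal I A \<Longrightarrow> skb_genideal A I = I"
  by (auto simp: skb_genideal_def)

(* The two bits are the components of the quotient map from I onto I / {0, 8} = (Z/2)^2, under which
   both operations of I become addition. *)
lemma evens16_quotient:
  assumes "m \<in> evens16" "n \<in> evens16"
  shows "odd (add4 m n div 4) \<longleftrightarrow> odd (m div 4) \<noteq> odd (n div 4)"
    "odd (add4 m n div 2) \<longleftrightarrow> odd (m div 2) \<noteq> odd (n div 2)"
    "odd (circ4 m n div 4) \<longleftrightarrow> odd (m div 4) \<noteq> odd (n div 4)"
    "odd (circ4 m n div 2) \<longleftrightarrow> odd (m div 2) \<noteq> odd (n div 2)"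
proof -
  have "\<forall>m\<in>evens16. \<forall>n\<in>evens16.
      (odd (add4 m n div 4) \<longleftrightarrow> odd (m div 4) \<noteq> odd (n div 4)) \<and>
      (odd (add4 m n div 2) \<longleftrightarrow> odd (m div 2) \<noteq> odd (n div 2)) \<and>
      (odd (circ4 m n div 4) \<longleftrightarrow> odd (m div 4) \<noteq> odd (n div 4)) \<and>
      (odd (circ4 m n div 2) \<longleftrightarrow> odd (m div 2) \<noteq> odd (n div 2))"
    unfolding evens16_def ball_simps by (simp add: ops4_defs)
  from this[rule_format, OF assms] show "odd (add4 m n div 4) \<longleftrightarrow> odd (m div 4) \<noteq> odd (n div 4)"
    "odd (add4 m n div 2) \<longleftrightarrow> odd (m div 2) \<noteq> odd (n div 2)"
    "odd (circ4 m n div 4) \<longleftrightarrow> odd (m div 4) \<noteq> odd (n div 4)"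
    "odd (circ4 m n div 2) \<longleftrightarrow> odd (m div 2) \<noteq> odd (n div 2)"
    by (simp_all only:)
qed

lemma evens16_quotient_inverse:
  assumes "m \<in> evens16"
  shows "odd (neg4 m div 4) \<longleftrightarrow> odd (m div 4)" "odd (neg4 m div 2) \<longleftrightarrow> odd (m div 2)"
    "odd (cinv4 m div 4) \<longleftrightarrow> odd (m div 4)" "odd (cinv4 m div 2) \<longleftrightarrow> odd (m div 2)"
proof -
  have "\<forall>m\<in>evens16. (odd (neg4 m div 4) \<longleftrightarrow> odd (m div 4)) \<and>
      (odd (neg4 m div 2) \<longleftrightarrow> odd (m div 2)) \<and>
      (odd (cinv4 m div 4) \<longleftrightarrow> odd (m div 4)) \<and>
      (odd (cinv4 m div 2) \<longleftrightarrow> odd (m div 2))"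
    unfolding evens16_def ball_simps by (simp add: ops4_defs)
  from this[rule_format, OF assms]
  show "odd (neg4 m div 4) \<longleftrightarrow> odd (m div 4)" "odd (neg4 m div 2) \<longleftrightarrow> odd (m div 2)"
    "odd (cinv4 m div 4) \<longleftrightarrow> odd (m div 4)" "odd (cinv4 m div 2) \<longleftrightarrow> odd (m div 2)"
    by (simp_all only:)
qed

lemma evens16_quotient_kernel:
  "m \<in> evens16 \<Longrightarrow> \<not> odd (m div 4) \<Longrightarrow> \<not> odd (m div 2) \<Longrightarrow> m \<in> {0, 8}"
  by (auto simp: evens16_def)

section \<open>The Higgins commutator of I with itself\<close>

text \<open>In each of the three kinds of generators every variable occurs exactly twice. In the
  quotient (Z/2)^2 both operations are addition and inverses are trivial, so the occurrences cancel;
  \<open>blast\<close> closes the resulting parity tautologies.\<close>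

lemma higgins_generators_evens16:
  "higgins_generators (brace4 {..<16}) evens16 evens16 \<subseteq> {0, 8}"
proof -
  note closed = closed4D[OF closed4_evens16]
  have a_inv: "\<ominus>\<^bsub>brace4 {..<16}\<^esub> m = neg4 m" and m_inv: "inv\<^bsub>brace4 {..<16}\<^esub> m = cinv4 m"
    if "m \<in> evens16" for m
    using that a_inv_brace4[OF closed4_full] m_inv_brace4[OF closed4_full] closed(1) by auto
  have "x \<in> evens16 \<and> \<not> odd (x div 4) \<and> \<not> odd (x div 2)"
    if "x \<in> higgins_generators (brace4 {..<16}) evens16 evens16" for x
    using that unfolding higgins_generators_def
    by (elim UnE CollectE exE conjE)
      (simp_all only: brace4_simps a_minus_def a_inv m_inv closed evens16_quotient
        evens16_quotient_inverse, blast+)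
  then show ?thesis using evens16_quotient_kernel by blast
qed

lemma eight_in_higgins_generators:
  "8 \<in> higgins_generators (brace4 {..<16}) evens16 evens16"
proof -
  let ?A = "brace4 {..<16}"
  \<comment> \<open>This is kind (iii) with i1 = j2 = (1,0) and i2 = j1 = 0. As (1,0) is its own
    circle inverse, the value is -(1,0) - (1,0) = (2,0).\<close>
  have "8 = \<ominus>\<^bsub>?A\<^esub> (4 \<otimes>\<^bsub>?A\<^esub> 0) \<ominus>\<^bsub>?A\<^esub> (0 \<otimes>\<^bsub>?A\<^esub> 4) \<oplus>\<^bsub>?A\<^esub> (4 \<oplus>\<^bsub>?A\<^esub> 0) \<otimes>\<^bsub>?A\<^esub> (0 \<oplus>\<^bsub>?A\<^esub> 4)"
    by (simp add: a_minus_def a_inv_brace4[OF closed4_full] ops4_defs)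
  moreover have "0 \<in> evens16" "4 \<in> evens16" by (simp_all add: evens16_def)
  ultimately show ?thesis unfolding higgins_generators_def by blast
qed

lemma higgins_commutator_not_ideal:
  "\<not> skb_ideal (higgins_commutator (brace4 {..<16}) evens16 evens16) (brace4 {..<16})"
proof
  let ?A = "brace4 {..<16}" and ?X = "higgins_commutator (brace4 {..<16}) evens16 evens16"
  assume "skb_ideal ?X ?A"
  then have normal: "?X \<lhd> ?A" by (simp add: skb_ideal_def)
  \<comment> \<open>The join of I with itself is I, so the ambient brace of the commutator is
    \<open>brace4 evens16\<close>.\<close>
  have X: "?X = skb_genideal (brace4 evens16) (higgins_generators ?A evens16 evens16)"
    by (simp add: higgins_commutator_def ideal_join_def skb_genideal_self[OF skb_ideal_evens16])
  have "8 \<in> ?X"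
    unfolding X using eight_in_higgins_generators by (auto simp: skb_genideal_def)
  then have "1 \<otimes>\<^bsub>?A\<^esub> 8 \<otimes>\<^bsub>?A\<^esub> inv\<^bsub>?A\<^esub> 1 \<in> ?X"
    using normal.inv_op_closed2[OF normal, of 1] by simp
  \<comment> \<open>1 \<circ> 8 encodes (2,1) and the circle inverse of 1 encodes (0,3). The high
    bit of 2 flips (0,3) to (0,1), giving (2,2).\<close>
  then have "10 \<in> ?X"
    by (simp add: m_inv_brace4[OF closed4_full] ops4_defs)
  \<comment> \<open>{0, 8} is one of the ideals of I whose intersection defines the
    commutator.\<close>
  moreover have "?X \<subseteq> {0, 8}"
    unfolding X using skb_ideal_0_8 higgins_generators_evens16 by (auto simp: skb_genideal_def)
  ultimately show False by auto
qed

theorem mainTheorem4: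
  shows "\<not> condition_NH TYPE(nat) \<and>
    (\<exists>(A :: nat ring) I. skew_brace A \<and> skb_ideal I A \<and>
      \<not> skb_ideal (higgins_commutator A I I) A)"
  unfolding condition_NH_def
  using skew_brace_brace4[OF closed4_full] skb_ideal_evens16 higgins_commutator_not_ideal
  by blast

end
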